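(* Given any $\varepsilon>0$, there exist an irrational number $\alpha>0$, a positive integer $n$ and a modified $n$-square torus $\mathcal{P}$, obtained from the $n$-square torus by the addition of a one-sided barrier, such that the recurrent set $\mathcal{R}(\mathcal{P};\alpha)$ under dissipative flow of slope $\alpha$ on $\mathcal{P}$ satisfies $$\frac{\lambda_2(\mathcal{R}(\mathcal{P};\alpha))}{n}<\varepsilon .$$
   Context: $\lambda_2$ denotes $2$-dimensional Lebesgue measure. The $n$-square torus is $[0,n)\times[0,1)$ with opposite edges identified by translation; its atomic squares are $[i-1,i)\times[0,1)$, $i=1,\ldots,n$. A one-sided barrier is a set $B=\{i\}\times J$ on a common vertical edge of two adjacent atomic squares, where $1\le i\le n-1$ and $J\subset[0,1)$ is a union of finitely many intervals of positive length; the corresponding set on the left vertical edge is $A=\{0\}\times J$. Dissipative flow of slope $\alpha$: a flow line moves from left to right at unit speed in the direction $(1,\alpha)$ as on the ordinary $n$-square torus, except that whenever it hits a point $(i,y)\in B$ from the left it continues, in the same direction, from the corresponding point $(0,y)\in A$. (A flow line that starts on $B$ emanates from the right side of $B$.) For $t\ge0$, $\mathbf{T}_\alpha^{(t)}$ is the operator which advances a point along its dissipative flow line by time $t$. A point $P\in\mathcal{P}$ is wandering if there exist an open neighbourhood $D$ of $P$ and $t_0\ge0$ such that $D\cap\mathbf{T}_\alpha^{(t)}(D)=\emptyset$ for every $t>t_0$; otherwise it is non-wandering. The recurrent set $\mathcal{R}(\mathcal{P};\alpha)$ is the set of all non-wandering points of $\mathcal{P}$. *)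

theory Defs
  imports "HOL-Analysis.Analysis" "HOL-Library.Real_Mod"
begin

definition torus :: "nat \<Rightarrow> (real \<times> real) set" where
  "torus n = {0..<real n} \<times> {0..<1}"

definition torus_proj :: "nat \<Rightarrow> real \<times> real \<Rightarrow> real \<times> real" where
  "torus_proj n = (\<lambda>(x, y). (x rmod real n, frac y))"

text \<open>
  The torus topology is the quotient topology coming from the plane. Any other convention for
  neighbourhoods of points on the slit (and on its partner on the left edge) changes the set of
  non-wandering points only on vertical edges, that is, on a null set.
\<close>

definition torus_topology :: "nat \<Rightarrow> (real \<times> real) topology" where
  "torus_topology n = topology (\<lambda>D. D \<subseteq> torus n \<and> open (torus_proj n -` D))"

lemma openin_torus_topology:
  "openin (torus_topology n) D \<longleftrightarrow> D \<subseteq> torus n \<and> open (torus_proj n -` D)"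
proof -
  have "istopology (\<lambda>D. D \<subseteq> torus n \<and> open (torus_proj n -` D))"
    unfolding istopology_def by (auto simp: vimage_Union)
  then show ?thesis
    unfolding torus_topology_def by simp
qed

lemma torus_proj_in_torus: "n > 0 \<Longrightarrow> torus_proj n p \<in> torus n"
  by (cases p) (auto simp: torus_proj_def torus_def frac_lt_1 rmod_nonneg rmod_less)

lemma torus_proj_ident: "p \<in> torus n \<Longrightarrow> torus_proj n p = p"
  by (cases p) (auto simp: torus_proj_def torus_def frac_eq rmod_idem)

lemma topspace_torus_topology: "n > 0 \<Longrightarrow> topspace (torus_topology n) = torus n"
proof -
  assume "n > 0"
  then have "torus_proj n -` torus n = UNIV"
    using torus_proj_in_torus by auto
  then have "openin (torus_topology n) (torus n)"
    by (simp add: openin_torus_topology)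
  then show ?thesis
    by (meson openin_subset openin_topspace openin_torus_topology subset_antisym)
qed

definition one_sided_barrier :: "nat \<Rightarrow> (real \<times> real) set \<Rightarrow> bool" where
  "one_sided_barrier n B \<longleftrightarrow>
    (\<exists>(i::nat) J. 1 \<le> i \<and> i < n \<and> B = {real i} \<times> J \<and> J \<subset> {0..<1} \<and>
      (\<exists>F. finite F \<and> F \<noteq> {} \<and> J = \<Union>F \<and>
        (\<forall>I\<in>F. is_interval I \<and> 0 < measure lborel I)))"

text \<open>
  Where a flow line that reaches the point \<open>(x, y)\<close> of a vertical edge from the left continues:
  both the right edge of the last square and the barrier send it to the left edge of the
  first square.
\<close>

definition cross_edge :: "nat \<Rightarrow> (real \<times> real) set \<Rightarrow> real \<times> real \<Rightarrow> real \<times> real" where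
  "cross_edge n B = (\<lambda>(x, y). if x = real n \<or> (x, y) \<in> B then (0, y) else (x, y))"

text \<open>
  Here \<open>h\<close> is the horizontal distance still to be travelled and \<open>d\<close> the horizontal
  distance to the next vertical edge. The starting point itself is never tested for lying on the
  barrier, so a flow line starting there leaves to the right; a flow line arriving at the
  barrier is already on the left edge at the moment of arrival.
\<close>

function advance :: "nat \<Rightarrow> (real \<times> real) set \<Rightarrow> real \<Rightarrow> real \<Rightarrow> real \<times> real \<Rightarrow> real \<times> real" where
  "advance n B \<alpha> h (x, y) =
    (let d = of_int \<lfloor>x\<rfloor> + 1 - x in
      if h < d then (x + h, frac (y + \<alpha> * h))
      else advance n B \<alpha> (h - d) (cross_edge n B (x + d, frac (y + \<alpha> * d))))"
  by pat_completeness auto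
termination
proof (relation "Wellfounded.measure (\<lambda>(n, B, \<alpha>, h, x, y). nat \<lfloor>h + frac x\<rfloor>)", goal_cases)
  case 1
  show ?case by simp
next
  case (2 n B \<alpha> h x y d)
  have "h + frac x \<ge> 1"
    using 2 by (simp add: frac_def)
  then have "\<lfloor>h + frac x\<rfloor> \<ge> 1"
    by simp
  moreover have "frac (fst (cross_edge n B (x + d, z))) = 0" for z
    using 2(1) by (simp add: cross_edge_def frac_def)
  moreover have "\<lfloor>h - d\<rfloor> = \<lfloor>h + frac x\<rfloor> - 1"
  proof -
    have "h - d = h + frac x - 1"
      using 2(1) by (simp add: frac_def)
    then show ?thesis
      by (simp only: floor_diff_one)
  qed
  ultimately show ?case
    by (simp add: case_prod_unfold)
qed

declare advance.simps [simp del]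

text \<open>Unit speed in direction \<open>(1, \<alpha>)\<close> means horizontal speed \<open>1 / sqrt (1 + \<alpha>\<^sup>2)\<close>.\<close>

definition dissipative_flow ::
    "nat \<Rightarrow> (real \<times> real) set \<Rightarrow> real \<Rightarrow> real \<Rightarrow> real \<times> real \<Rightarrow> real \<times> real" where
  "dissipative_flow n B \<alpha> t p = advance n B \<alpha> (t / sqrt (1 + \<alpha>\<^sup>2)) p"

definition wandering :: "nat \<Rightarrow> (real \<times> real) set \<Rightarrow> real \<Rightarrow> real \<times> real \<Rightarrow> bool" where
  "wandering n B \<alpha> p \<longleftrightarrow>
    (\<exists>D t0. openin (torus_topology n) D \<and> p \<in> D \<and> t0 \<ge> 0 \<and>
      (\<forall>t>t0. D \<inter> dissipative_flow n B \<alpha> t ` D = {}))"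

definition recurrent_set :: "nat \<Rightarrow> (real \<times> real) set \<Rightarrow> real \<Rightarrow> (real \<times> real) set" where
  "recurrent_set n B \<alpha> = {p \<in> torus n. \<not> wandering n B \<alpha> p}"

text \<open>The measure of the recurrent set is therefore meaningful.\<close>

lemma recurrent_set_borel: "recurrent_set n B \<alpha> \<in> sets borel"
proof -
  define W where "W = \<Union>{D. openin (torus_topology n) D \<and>
    (\<exists>t0\<ge>0. \<forall>t>t0. D \<inter> dissipative_flow n B \<alpha> t ` D = {})}"
  have "openin (torus_topology n) W"
    unfolding W_def by (rule openin_Union) blast
  then have "open (torus_proj n -` W)"
    by (simp add: openin_torus_topology)
  moreover have "recurrent_set n B \<alpha> = torus n - torus_proj n -` W"
  proof -
    have "wandering n B \<alpha> p \<longleftrightarrow> p \<in> W" for p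
      unfolding wandering_def W_def by blast
    then show ?thesis
      unfolding recurrent_set_def using torus_proj_ident by auto
  qed
  moreover have "torus n \<in> sets borel"
    unfolding torus_def by (intro borel_Times) auto
  ultimately show ?thesis
    by auto
qed

lemma dissipative_flow_0: "p \<in> torus n \<Longrightarrow> dissipative_flow n B \<alpha> 0 p = p"
  by (cases p) (simp add: dissipative_flow_def torus_def advance.simps frac_eq Let_def)

end

theory Submission
  imports Defs
begin

text \<open>
  Put the barrier on the first interior vertical edge and let it leave open only a gap of
  length \<open>\<delta>\<close>. Every flow line returns to the first square, and from then on it can enter the
  remaining squares only through the gap. Hence outside the first square the recurrent set is
  contained in the strip swept out by the gap, of area at most \<open>2 \<delta> n\<close>, so its relative
  area is at most \<open>1 / n + 2 \<delta>\<close>.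
\<close>

section \<open>Invariance of the region fed by the gap\<close>

text \<open>For \<open>x \<ge> 1\<close> the quantity \<open>frac (y - \<alpha> * (x - 1))\<close>
  is the height at which the line of slope \<open>\<alpha>\<close> through the point, traced back,
  meets the barrier edge. The first square is included whole.\<close>

definition gap_region :: "nat \<Rightarrow> real set \<Rightarrow> real \<Rightarrow> (real \<times> real) set" where
  "gap_region n J \<alpha> = {(x, y). 0 \<le> x \<and> x < real n \<and> (1 \<le> x \<longrightarrow> frac (y - \<alpha> * (x - 1)) \<notin> J)}"

lemma frac_add_frac_eqI:
  fixes u :: real
  assumes "u + v = w"
  shows "frac (frac u + v) = frac w"
proof -
  have "frac u + v = w - of_int \<lfloor>u\<rfloor>"
    using assms by (simp add: frac_def)
  moreover have "frac (w - of_int \<lfloor>u\<rfloor>) = frac w"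
    by (simp add: frac_def)
  ultimately show ?thesis
    by simp
qed

text \<open>The height traced back to the edge \<open>x = 1\<close> is a first integral of the
  motion as long as no jump to the left edge occurs.\<close>

lemma frac_along_flow:
  fixes x y \<alpha> s :: real
  shows "frac (frac (y + \<alpha> * s) - \<alpha> * (x + s - 1)) = frac (y - \<alpha> * (x - 1))"
  using frac_add_frac_eqI[of "y + \<alpha> * s" "- \<alpha> * (x + s - 1)" "y - \<alpha> * (x - 1)"]
  by (simp add: algebra_simps)

lemma floor_add_one_le_nat:
  fixes x :: real
  assumes "x < real n"
  shows "of_int \<lfloor>x\<rfloor> + 1 \<le> real n"
proof -
  have "\<lfloor>x\<rfloor> < int n"
    using assms by (simp add: floor_less_iff)
  then have "of_int (\<lfloor>x\<rfloor> + 1) \<le> (of_int (int n) :: real)"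
    by (simp only: of_int_le_iff)
  then show ?thesis
    by simp
qed

lemma floor_add_one_ge_one:
  fixes x :: real
  assumes "0 \<le> x"
  shows "1 \<le> of_int \<lfloor>x\<rfloor> + (1::real)"
  using assms by simp

lemma floor_add_one_eq_one:
  fixes x :: real
  assumes "0 \<le> x" "x < 1"
  shows "of_int \<lfloor>x\<rfloor> + 1 = (1::real)"
  using assms by (simp add: floor_eq_iff)

text \<open>A jump lands at \<open>x = 0\<close>, where the region imposes no condition. Without a
  jump, either the line has just passed the first edge outside \<open>J\<close>, or the traced
  height is the old one.\<close>

lemma cross_edge_gap_region:
  fixes x y \<alpha> :: real
  assumes "(x, y) \<in> gap_region n J \<alpha>" and "d = of_int \<lfloor>x\<rfloor> + 1 - x"
  shows "cross_edge n ({1} \<times> J) (x + d, frac (y + \<alpha> * d)) \<in> gap_region n J \<alpha>"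
proof -
  have x: "0 \<le> x" "x < real n"
    using assms(1) by (auto simp: gap_region_def)
  have m: "x + d \<le> real n" "1 \<le> x + d"
    using floor_add_one_le_nat[OF x(2)] floor_add_one_ge_one[OF x(1)] assms(2) by auto
  have *: "frac (frac (y + \<alpha> * d) - \<alpha> * (x + d - 1)) \<notin> J"
    if "x + d \<noteq> 1 \<or> frac (y + \<alpha> * d) \<notin> J"
  \<comment> \<open>Only from the first square is the next edge the one with the barrier; there the
    traced height is the arrival height itself.\<close>
  proof (cases "x < 1")
    case True
    then have "x + d = 1"
      using floor_add_one_eq_one[OF x(1)] assms(2) by simp
    then show ?thesis
      using that by (simp add: frac_frac)
  next
    case False
    then show ?thesis
      using assms(1) by (simp add: gap_region_def frac_along_flow)
  qed
  show ?thesis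
    using * m x by (auto simp: cross_edge_def gap_region_def)
qed

lemma advance_gap_region:
  assumes "p \<in> gap_region n J \<alpha>" and "0 \<le> h"
  shows "advance n ({1} \<times> J) \<alpha> h p \<in> gap_region n J \<alpha>"
  using assms
proof (induction n "{1::real} \<times> J" \<alpha> h p rule: advance.induct)
  case (1 n \<alpha> h x y)
  define d where "d = of_int \<lfloor>x\<rfloor> + 1 - x"
  have x: "0 \<le> x" "x < real n"
    using "1.prems" by (auto simp: gap_region_def)
  show ?case
  proof (cases "h < d")
    case True
    have "x + h < real n"
      using True floor_add_one_le_nat[OF x(2)] by (simp add: d_def)
    \<comment> \<open>No edge is reached within distance \<open>h\<close>, so the line has not left
      its square and the condition on the traced height was already in force.\<close>
    moreover have "1 \<le> x" if "1 \<le> x + h"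
      using floor_add_one_eq_one[OF x(1)] True that by (fastforce simp: d_def)
    ultimately have "(x + h, frac (y + \<alpha> * h)) \<in> gap_region n J \<alpha>"
      using "1.prems" x by (simp add: gap_region_def frac_along_flow)
    then show ?thesis
      using True by (simp add: advance.simps[of _ _ _ _ x] Let_def d_def)
  next
    case False
    have "advance n ({1} \<times> J) \<alpha> (h - d) (cross_edge n ({1} \<times> J) (x + d, frac (y + \<alpha> * d)))
        \<in> gap_region n J \<alpha>"
      using "1.hyps"[OF d_def False] cross_edge_gap_region[OF "1.prems"(1) d_def] False by simp
    then show ?thesis
      using False by (simp add: advance.simps[of _ _ _ _ x] Let_def d_def)
  qed
qed

text \<open>A line with enough horizontal distance to reach the right edge is sent to the left edge
  there or earlier at the barrier. It is then in the region and stays by invariance.\<close>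

lemma advance_eventually_gap_region:
  assumes "p \<in> torus n" and "0 \<le> h" and "real n \<le> fst p + h"
  shows "advance n ({1} \<times> J) \<alpha> h p \<in> gap_region n J \<alpha>"
  using assms
proof (induction n "{1::real} \<times> J" \<alpha> h p rule: advance.induct)
  case (1 n \<alpha> h x y)
  define d where "d = of_int \<lfloor>x\<rfloor> + 1 - x"
  define z where "z = frac (y + \<alpha> * d)"
  have x: "0 \<le> x" "x < real n"
    using "1.prems" by (auto simp: torus_def)
  have m: "x + d \<le> real n" "1 \<le> x + d"
    using floor_add_one_le_nat[OF x(2)] floor_add_one_ge_one[OF x(1)] by (auto simp: d_def)
  have hd: "\<not> h < d"
    using m "1.prems" by simp
  have z: "0 \<le> z" "z < 1"
    by (simp_all add: z_def frac_lt_1)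
  have "advance n ({1} \<times> J) \<alpha> (h - d) (cross_edge n ({1} \<times> J) (x + d, z)) \<in> gap_region n J \<alpha>"
  proof (cases "x + d = real n \<or> (x + d, z) \<in> {1} \<times> J")
    case True
    then have "cross_edge n ({1} \<times> J) (x + d, z) = (0, z)"
      by (auto simp: cross_edge_def)
    moreover have "(0, z) \<in> gap_region n J \<alpha>"
      using x by (simp add: gap_region_def)
    ultimately show ?thesis
      using advance_gap_region hd by simp
  next
    \<comment> \<open>At an ordinary edge the position plus the remaining distance is unchanged, so
      the induction hypothesis applies.\<close>
    case False
    then have eq: "cross_edge n ({1} \<times> J) (x + d, z) = (x + d, z)"
      by (auto simp: cross_edge_def)
    have "(x + d, z) \<in> torus n"
      using False m z by (simp add: torus_def)
    then show ?thesis
      using "1.hyps"[OF d_def hd] "1.prems" hd eq by (simp add: z_def)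
  qed
  then show ?case
    using hd by (simp add: advance.simps[of _ _ _ _ x] Let_def d_def z_def)
qed

section \<open>Open strips of wandering points\<close>

text \<open>Replaces the discontinuous \<open>rmod\<close> by a union over integer translates: since
  \<open>P\<close> forces its argument into one period, the translate satisfying it must be the
  representative.\<close>

lemma rmod_cases_iff:
  fixes c x :: real
  assumes "0 < c" and "\<And>z. P z \<Longrightarrow> 0 \<le> z \<and> z < c"
  shows "P (x rmod c) \<longleftrightarrow> (\<exists>k::int. P (x - of_int k * c))"
proof
  assume "P (x rmod c)"
  moreover have "x rmod c = x - of_int \<lfloor>x / c\<rfloor> * c"
    using assms(1) by (simp add: rmod_def)
  ultimately show "\<exists>k::int. P (x - of_int k * c)"
    by metis
next
  assume "\<exists>k::int. P (x - of_int k * c)"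
  then obtain k :: int where k: "P (x - of_int k * c)" ..
  have "x rmod c = x - of_int k * c"
    using assms(2)[OF k] assms(1) by (intro rmod_unique[where n = k]) auto
  with k show "P (x rmod c)"
    by simp
qed

text \<open>The strip stays off the vertical edges bounding its range of \<open>x\<close>, and the
  cut at \<open>y = 0\<close> disappears in the quotient, so its preimage in the plane is a union of
  open sheared strips.\<close>

lemma openin_torus_sheared_strip:
  assumes "0 < n" and "r \<le> 1"
  shows "openin (torus_topology n)
    {(x, y). 1 < x \<and> x < real n \<and> 0 \<le> y \<and> y < 1 \<and> frac (y - \<alpha> * (x - 1)) \<in> {0<..<r}}"
    (is "openin _ ?D")
proof -
  have sub: "?D \<subseteq> torus n"
    by (auto simp: torus_def)
  \<comment> \<open>\<open>k\<close> counts horizontal periods and \<open>m\<close> is the integer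
    part of the traced height.\<close>
  define U where "U = (\<lambda>(k::int) (m::int).
    {p :: real \<times> real. 1 < fst p - of_int k * real n \<and> fst p - of_int k * real n < real n \<and>
      0 < snd p - \<alpha> * (fst p - of_int k * real n - 1) - of_int m \<and>
      snd p - \<alpha> * (fst p - of_int k * real n - 1) - of_int m < r})"
  have "(x, y) \<in> torus_proj n -` ?D \<longleftrightarrow> (\<exists>k m. (x, y) \<in> U k m)" for x y
  proof -
    have "(x, y) \<in> torus_proj n -` ?D \<longleftrightarrow>
      x rmod real n \<in> {1<..<real n} \<and> frac (y - \<alpha> * (x rmod real n - 1)) \<in> {0<..<r}"
    proof -
      have "frac (frac y - \<alpha> * (x rmod real n - 1)) = frac (y - \<alpha> * (x rmod real n - 1))"
        using frac_add_frac_eqI[of y "- \<alpha> * (x rmod real n - 1)"] by simp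
      then show ?thesis
        by (auto simp: torus_proj_def frac_lt_1 simp del: frac_gt_0_iff)
    qed
    also have "\<dots> \<longleftrightarrow> (\<exists>k::int. x - of_int k * real n \<in> {1<..<real n} \<and>
      frac (y - \<alpha> * (x - of_int k * real n - 1)) \<in> {0<..<r})"
      using assms(1)
      by (intro rmod_cases_iff[where P = "\<lambda>z. z \<in> {1<..<real n} \<and> frac (y - \<alpha> * (z - 1)) \<in> {0<..<r}"])
        auto
    also have "\<dots> \<longleftrightarrow> (\<exists>k m. (x, y) \<in> U k m)"
    proof -
      \<comment> \<open>\<open>frac\<close> is \<open>rmod\<close> with period 1, and
        \<open>r \<le> 1\<close> keeps the interval within one period.\<close>
      have "frac v \<in> {0<..<r} \<longleftrightarrow> (\<exists>m::int. v - of_int m \<in> {0<..<r})" for v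
        using rmod_cases_iff[of 1 "\<lambda>z. z \<in> {0<..<r}" v] assms(2) by (simp add: rmod_def frac_def)
      then show ?thesis
        by (simp add: U_def)
    qed
    finally show ?thesis .
  qed
  then have eq: "torus_proj n -` ?D = (\<Union>k. \<Union>m. U k m)"
    by (intro set_eqI) (metis (no_types, lifting) UN_iff UNIV_I surj_pair)
  have "open (U k m)" for k m
    unfolding U_def by (intro open_Collect_conj open_Collect_less continuous_intros)
  then have "open (torus_proj n -` ?D)"
    unfolding eq by (intro open_UN ballI)
  with sub show ?thesis
    by (simp add: openin_torus_topology)
qed

text \<open>The open strip of lines that would have had to pass through the barrier is disjoint from
  the gap region, which eventually contains all its images.\<close>

lemma wandering_if_not_gap:
  assumes "0 < n" and "r \<le> 1"
    and "1 < x" "x < real n" "0 \<le> y" "y < 1" "frac (y - \<alpha> * (x - 1)) \<in> {0<..<r}"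
  shows "wandering n ({1} \<times> {0..<r}) \<alpha> (x, y)"
proof -
  define D where "D = {(x, y). 1 < x \<and> x < real n \<and> 0 \<le> y \<and> y < 1 \<and> frac (y - \<alpha> * (x - 1)) \<in> {0<..<r}}"
  have pos: "0 < sqrt (1 + \<alpha>\<^sup>2)"
    by (simp add: add_pos_nonneg)
  \<comment> \<open>By time \<open>real n * sqrt (1 + \<alpha>\<^sup>2)\<close> every line has
    travelled the horizontal distance \<open>n\<close>.\<close>
  have disjoint: "D \<inter> dissipative_flow n ({1} \<times> {0..<r}) \<alpha> t ` D = {}"
    if t: "real n * sqrt (1 + \<alpha>\<^sup>2) < t" for t
  proof -
    have h: "real n < t / sqrt (1 + \<alpha>\<^sup>2)"
      using t pos by (simp add: pos_less_divide_eq)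
    have "dissipative_flow n ({1} \<times> {0..<r}) \<alpha> t p \<in> gap_region n {0..<r} \<alpha>" if "p \<in> D" for p
      unfolding dissipative_flow_def using that h
      by (intro advance_eventually_gap_region) (auto simp: D_def torus_def)
    moreover have "D \<inter> gap_region n {0..<r} \<alpha> = {}"
      by (auto simp: D_def gap_region_def)
    ultimately show ?thesis
      by blast
  qed
  show ?thesis
    unfolding wandering_def
  proof (intro exI conjI allI impI)
    show "openin (torus_topology n) D"
      unfolding D_def using assms(1,2) by (rule openin_torus_sheared_strip)
    show "(x, y) \<in> D"
      using assms(3-) by (simp add: D_def)
    show "0 \<le> real n * sqrt (1 + \<alpha>\<^sup>2)"
      using pos by simp
  qed (rule disjoint)
qed

section \<open>Area of the recurrent set\<close>

lemma emeasure_shifted_gap_le: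
  fixes c \<delta> :: real
  assumes "0 \<le> \<delta>" and "S \<subseteq> {y. 0 \<le> y \<and> y < 1 \<and> frac (y - c) \<notin> {0<..<1 - \<delta>}}"
  shows "emeasure lborel S \<le> ennreal (2 * \<delta>)"
proof -
  define b where "b = frac c"
  have b: "0 \<le> b" "b < 1"
    by (simp_all add: b_def frac_lt_1)
  \<comment> \<open>Modulo 1 the set is an interval of length \<open>\<delta>\<close> ending at
    \<open>c\<close>. In the unit interval it may wrap around, and two full copies cover both
    pieces, whence the factor 2.\<close>
  have "S \<subseteq> {b - \<delta>..b} \<union> {b + 1 - \<delta>..b + 1}"
  proof
    fix y assume "y \<in> S"
    then have y: "0 \<le> y" "y < 1" "frac (y - c) \<notin> {0<..<1 - \<delta>}"
      using assms(2) by auto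
    have "frac (y - c) = frac (y - b)"
    proof -
      have "y - b = y - c + of_int \<lfloor>c\<rfloor>"
        by (simp add: b_def frac_def)
      moreover have "frac (y - c + of_int \<lfloor>c\<rfloor>) = frac (y - c)"
        by (simp add: frac_def)
      ultimately show ?thesis
        by (simp only:)
    qed
    also have "\<dots> = (if b \<le> y then y - b else y - b + 1)"
    proof -
      have "\<lfloor>y - b\<rfloor> = (if b \<le> y then 0 else - 1)"
        using y b by (auto simp: floor_eq_iff)
      then show ?thesis
        by (simp add: frac_def)
    qed
    finally show "y \<in> {b - \<delta>..b} \<union> {b + 1 - \<delta>..b + 1}"
      using y b assms(1) by (auto split: if_splits)
  qed
  then have "emeasure lborel S \<le> emeasure lborel ({b - \<delta>..b} \<union> {b + 1 - \<delta>..b + 1})"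
    by (rule emeasure_mono) simp
  also have "\<dots> \<le> emeasure lborel {b - \<delta>..b} + emeasure lborel {b + 1 - \<delta>..b + 1}"
    by (rule emeasure_subadditive) auto
  also have "\<dots> = ennreal (2 * \<delta>)"
    using assms(1) by (simp flip: ennreal_plus)
  finally show ?thesis .
qed

text \<open>Integrate over vertical slices: those over the first square have length at most 1, all
  others at most \<open>2 * \<delta>\<close>.\<close>

lemma measure_recurrent_set_le:
  assumes "0 < n" and "0 \<le> \<delta>"
  shows "measure lborel (recurrent_set n ({1} \<times> {0..<1 - \<delta>}) \<alpha>) \<le> 1 + 2 * \<delta> * real n"
proof -
  let ?R = "recurrent_set n ({1} \<times> {0..<1 - \<delta>}) \<alpha>"
  have sets: "?R \<in> sets (lborel \<Otimes>\<^sub>M lborel)"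
    using recurrent_set_borel by (metis lborel_prod sets_lborel)
  have slice: "emeasure lborel (Pair x -` ?R) \<le>
    indicator {0..1} x + ennreal (2 * \<delta>) * indicator {0..real n} x" for x
  proof (cases "0 \<le> x \<and> x < real n")
    case False
    then have "Pair x -` ?R = {}"
      by (auto simp: recurrent_set_def torus_def)
    then show ?thesis
      by simp
  next
    case x: True
    show ?thesis
    proof (cases "x \<le> 1")
      case True
      have "emeasure lborel (Pair x -` ?R) \<le> emeasure lborel {0..<1::real}"
        by (rule emeasure_mono) (auto simp: recurrent_set_def torus_def)
      also have "\<dots> \<le> indicator {0..1} x + ennreal (2 * \<delta>) * indicator {0..real n} x"
        using True x by simp
      finally show ?thesis .
    next
      case False
      have "frac (y - \<alpha> * (x - 1)) \<notin> {0<..<1 - \<delta>}" if "(x, y) \<in> ?R" for y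
        using wandering_if_not_gap[of n "1 - \<delta>" x y \<alpha>] that assms x False
        by (auto simp: recurrent_set_def torus_def)
      then have "emeasure lborel (Pair x -` ?R) \<le> ennreal (2 * \<delta>)"
        using assms(2)
        by (intro emeasure_shifted_gap_le[where c = "\<alpha> * (x - 1)"])
          (auto simp: recurrent_set_def torus_def)
      then show ?thesis
        using x False by simp
    qed
  qed
  have "emeasure lborel ?R = (\<integral>\<^sup>+x. emeasure lborel (Pair x -` ?R) \<partial>lborel)"
    using lborel.emeasure_pair_measure_alt[OF sets] by (simp add: lborel_prod)
  also have "\<dots> \<le> (\<integral>\<^sup>+x. indicator {0..1} x + ennreal (2 * \<delta>) * indicator {0..real n} x \<partial>lborel)"
    by (rule nn_integral_mono) (rule slice)
  also have "\<dots> = ennreal 1 + ennreal (2 * \<delta>) * ennreal (real n)"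
    by (simp add: nn_integral_add nn_integral_cmult)
  also have "\<dots> = ennreal (1 + 2 * \<delta> * real n)"
    using assms(2) by (simp only: ennreal_plus ennreal_mult mult_nonneg_nonneg of_nat_0_le_iff
        zero_le_numeral zero_le_one)
  finally show ?thesis
    using assms(2) by (simp add: measure_def enn2real_leI)
qed

section \<open>Admissible barrier and choice of parameters\<close>

lemma one_sided_barrier_initial_segment:
  assumes "1 < n" and "0 < r" and "r < 1"
  shows "one_sided_barrier n ({1} \<times> {0..<r})"
proof -
  have "r \<in> {0..<1}" "r \<notin> {0..<r}" "{0..<r} \<subseteq> {0..<1}"
    using assms by auto
  then have "{0..<r} \<subset> {0..<1}"
    by blast
  moreover have "finite {{0..<r}}" "{{0..<r}} \<noteq> {}" "{0..<r} = \<Union>{{0..<r}}"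
    "\<forall>I\<in>{{0..<r}}. is_interval I \<and> 0 < measure lborel I"
    using assms(2) by (simp_all add: is_interval_co)
  moreover have "1 \<le> (1::nat)" "{1} \<times> {0..<r} = {real 1} \<times> {0..<r}"
    by simp_all
  ultimately show ?thesis
    unfolding one_sided_barrier_def using assms(1) by blast
qed

lemma ex_pos_irrational: "\<exists>\<alpha>::real. \<alpha> \<notin> \<rat> \<and> 0 < \<alpha>"
proof -
  have "\<not> {0<..<1::real} \<subseteq> \<rat>"
    using uncountable_open_interval[of 0 "1::real"] countable_subset[OF _ countable_rat] by auto
  then show ?thesis
    by auto
qed

theorem theorem2:
  fixes \<epsilon> :: real
  assumes "\<epsilon> > 0"
  shows "\<exists>(\<alpha>::real) (n::nat) B. \<alpha> \<notin> \<rat> \<and> \<alpha> > 0 \<and> n > 0 \<and> one_sided_barrier n B \<and>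
    measure lborel (recurrent_set n B \<alpha>) / real n < \<epsilon>"
proof -
  obtain \<alpha> :: real where \<alpha>: "\<alpha> \<notin> \<rat>" "0 < \<alpha>"
    using ex_pos_irrational by blast
  \<comment> \<open>The bound \<open>\<epsilon> / 4\<close> makes the strip contribute at most
    \<open>\<epsilon> / 2\<close> to the ratio; \<open>1 / 2\<close> keeps the barrier of positive
    length.\<close>
  define \<delta> where "\<delta> = min (\<epsilon> / 4) (1 / 2)"
  have \<delta>: "0 < \<delta>" "\<delta> < 1" "2 * \<delta> \<le> \<epsilon> / 2"
    using assms by (auto simp: \<delta>_def)
  \<comment> \<open>With \<open>n > 2 / \<epsilon>\<close> the first square contributes less than
    \<open>\<epsilon> / 2\<close>; \<open>n > 1\<close> provides an interior edge.\<close>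
  obtain n :: nat where n: "max 1 (2 / \<epsilon>) < real n"
    using reals_Archimedean2 by blast
  then have n1: "1 < n" "0 < n"
    by auto
  have "2 < \<epsilon> * real n"
    using n assms by (simp add: field_simps)
  let ?B = "{1} \<times> {0..<1 - \<delta>}"
  have "measure lborel (recurrent_set n ?B \<alpha>) \<le> 1 + 2 * \<delta> * real n"
    using measure_recurrent_set_le n1 \<delta> by simp
  also have "\<dots> \<le> 1 + \<epsilon> / 2 * real n"
    using \<delta>(3) by (intro add_left_mono mult_right_mono) auto
  also have "\<dots> < \<epsilon> * real n"
    using \<open>2 < \<epsilon> * real n\<close> by simp
  finally have "measure lborel (recurrent_set n ?B \<alpha>) / real n < \<epsilon>"
    using n1 by (simp add: pos_divide_less_eq)
  moreover have "one_sided_barrier n ?B"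
    using one_sided_barrier_initial_segment n1 \<delta> by simp
  ultimately show ?thesis
    using \<alpha> n1 by blast
qed

end
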